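(* Let $\lambda$ and $\mu$ be partitions of lengths $r_1$ and $r_2$, let $r=r_1+r_2$, and let $\alpha\in\mathbb{R}$ with $\alpha+r>-1$. Let $z_j\in\mathbb{C}\setminus[0,\infty)$ be a simple zero of the generalized Laguerre polynomial $\Omega^{(\alpha)}_{\lambda,\mu}$. For $n\in\mathbb{N}_{\lambda,\mu}$ let $N(n)$ be the number of zeros of the exceptional Laguerre polynomial $L^{(\alpha)}_{\lambda,\mu,n}$ in $(0,\infty)$ counted with multiplicity, and let $z^{(\alpha)}_{1,n},\dots,z^{(\alpha)}_{n-N(n),n}$ denote its remaining zeros (the exceptional zeros, i.e. the zeros in $\mathbb{C}\setminus(0,\infty)$ listed with multiplicity). Then there is a constant $c>0$ (independent of $n$) such that for all $n\in\mathbb{N}_{\lambda,\mu}$ large enough $$\min_{k=1,\dots,n-N(n)}\left|z_j-z^{(\alpha)}_{k,n}\right|<\frac{c}{\sqrt{n}}.$$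
   Context: For $\alpha\in\mathbb{R}$ and an integer $n\ge 0$, $L^{(\alpha)}_n(x)=\frac{e^x x^{-\alpha}}{n!}\frac{d^n}{dx^n}\left(e^{-x}x^{n+\alpha}\right)$ is the Laguerre polynomial of degree $n$ (so $L_n^{(\alpha)}(x)=\sum_{k=0}^n\binom{n+\alpha}{n-k}\frac{(-x)^k}{k!}$). For sufficiently differentiable functions, $\mathrm{Wr}[f_1,\dots,f_r]=\det\left(\frac{d^{j-1}}{dx^{j-1}}f_i\right)_{1\le i,j\le r}$ is the Wronskian (the empty Wronskian is $1$). A partition $\lambda=(\lambda_1,\dots,\lambda_{r_1})$ is a weakly decreasing (possibly empty) finite sequence of positive integers, $r_1$ is its length and $|\lambda|=\sum_j\lambda_j$. To partitions $\lambda$ of length $r_1$ and $\mu$ of length $r_2$ associate $n_j=\lambda_j+r_1-j$ ($1\le j\le r_1$), $m_j=\mu_j+r_2-j$ ($1\le j\le r_2$), $r=r_1+r_2$, and the functions $f_j(x)=L^{(\alpha)}_{n_j}(x)$ for $j=1,\dots,r_1$ and $f_{r_1+j}(x)=e^xL^{(\alpha)}_{m_j}(-x)$ for $j=1,\dots,r_2$. The generalized Laguerre polynomial is $\Omega^{(\alpha)}_{\lambda,\mu}(x)=e^{-r_2x}\,\mathrm{Wr}[f_1,\dots,f_r](x)$; it is a polynomial of degree $|\lambda|+|\mu|$. The degree sequence is $$\mathbb{N}_{\lambda,\mu}=\{n\in\{0,1,2,\dots\} : n\ge|\lambda|+|\mu|-r_1 \text{ and } n-|\lambda|-|\mu|\ne\lambda_j-j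 \text{ for } j=1,\dots,r_1\}.$$ For $n\in\mathbb{N}_{\lambda,\mu}$ the exceptional Laguerre polynomial is $$L^{(\alpha)}_{\lambda,\mu,n}(x)=e^{-r_2x}\,\mathrm{Wr}\left[f_1,\dots,f_r,L^{(\alpha)}_s\right](x),\qquad s=n-|\lambda|-|\mu|+r_1,$$ which is a polynomial of degree $n$. *)

theory Defs
  imports "HOL-Analysis.Derivative" "Jordan_Normal_Form.Determinant"
begin

text \<open>The explicit sum rather than the Rodrigues formula, so that the definition makes sense on all of
  \<open>\<complex>\<close> without a branch of \<open>x powr \<alpha>\<close>; the two are shown to agree for \<open>x > 0\<close> below.\<close>

definition laguerre :: "real \<Rightarrow> nat \<Rightarrow> 'a::real_normed_field \<Rightarrow> 'a" where
  "laguerre \<alpha> n x = (\<Sum>k\<le>n. of_real ((real n + \<alpha>) gchoose (n - k)) * ((- x) ^ k / fact k))"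

lemma deriv_iter_aux:
  fixes b :: real
  assumes "x > 0"
  shows "(deriv ^^ m) (\<lambda>x. exp (- x) * x powr b) x =
    (\<Sum>k\<le>m. of_nat (m choose k) * (-1) ^ k * (fact (m - k) * (b gchoose (m - k))) *
       (exp (- x) * x powr (b - real (m - k))))"
  using assms
proof (induction m arbitrary: x)
  case 0
  then show ?case by simp
next
  case (Suc m)
  let ?c = "\<lambda>j. fact j * (b gchoose j)"
  let ?g = "\<lambda>j x. exp (- x) * x powr (b - real j)"
  let ?S = "\<lambda>x. \<Sum>k\<le>m. of_nat (m choose k) * (-1) ^ k * ?c (m - k) * ?g (m - k) x"
  have c: "?c (Suc j) = ?c j * (b - real j)" for j
    by (simp only: gbinomial_mult_fact prod.atLeast0_lessThan_Suc)
  have ev: "eventually (\<lambda>y. (deriv ^^ m) (\<lambda>x. exp (- x) * x powr b) y = ?S y) (nhds x)"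
    using eventually_nhds_in_open[of "{0<..}" x] Suc.prems
    by (auto elim!: eventually_mono simp: Suc.IH)
  have dg: "(?g j has_real_derivative (- ?g j x + (b - real j) * ?g (Suc j) x)) (at x)" for j
    using Suc.prems by (auto intro!: derivative_eq_intros simp: algebra_simps)
  have "(?S has_real_derivative (\<Sum>k\<le>m. of_nat (m choose k) * (-1) ^ k * ?c (m - k) *
      (- ?g (m - k) x + (b - real (m - k)) * ?g (Suc (m - k)) x))) (at x)"
    by (intro DERIV_sum DERIV_cmult dg)
  hence "deriv ?S x = (\<Sum>k\<le>m. of_nat (m choose k) * (-1) ^ k * ?c (m - k) *
      (- ?g (m - k) x + (b - real (m - k)) * ?g (Suc (m - k)) x))"
    by (rule DERIV_imp_deriv)
  also have "\<dots> = (\<Sum>k\<le>m. of_nat (m choose k) * (-1) ^ Suc k * ?c (m - k) * ?g (m - k) x)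
     + (\<Sum>k\<le>m. of_nat (m choose k) * (-1) ^ k * ?c (Suc m - k) * ?g (Suc m - k) x)"
    unfolding sum.distrib[symmetric]
    by (intro sum.cong refl) (simp add: Suc_diff_le c algebra_simps del: fact_Suc)
  also have "(\<Sum>k\<le>m. of_nat (m choose k) * (-1) ^ Suc k * ?c (m - k) * ?g (m - k) x)
     = (\<Sum>k\<le>Suc m. of_nat (case k of 0 \<Rightarrow> 0 | Suc i \<Rightarrow> m choose i) * (-1) ^ k * ?c (Suc m - k) * ?g (Suc m - k) x)"
    by (subst sum.atMost_Suc_shift) simp
  also have "(\<Sum>k\<le>m. of_nat (m choose k) * (-1) ^ k * ?c (Suc m - k) * ?g (Suc m - k) x)
     = (\<Sum>k\<le>Suc m. of_nat (m choose k) * (-1) ^ k * ?c (Suc m - k) * ?g (Suc m - k) x)"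
    by simp
  also have "(\<Sum>k\<le>Suc m. of_nat (case k of 0 \<Rightarrow> 0 | Suc i \<Rightarrow> m choose i) * (-1) ^ k * ?c (Suc m - k) * ?g (Suc m - k) x) + (\<Sum>k\<le>Suc m. of_nat (m choose k) * (-1) ^ k * ?c (Suc m - k) * ?g (Suc m - k) x)
    = (\<Sum>k\<le>Suc m. of_nat (Suc m choose k) * (-1) ^ k * ?c (Suc m - k) * ?g (Suc m - k) x)"
    unfolding sum.distrib[symmetric]
    by (intro sum.cong refl) (simp add: algebra_simps split: nat.splits del: fact_Suc)
  finally show ?case
    using deriv_cong_ev[OF ev refl] by simp
qed

text \<open>The Rodrigues formula, for positive real arguments.\<close>

lemma laguerre_rodrigues:
  fixes x \<alpha> :: real
  assumes "x > 0"
  shows "laguerre \<alpha> n x = exp x * x powr (- \<alpha>) / fact n *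
           (deriv ^^ n) (\<lambda>x. exp (- x) * x powr (real n + \<alpha>)) x"
proof -
  have *: "exp x * x powr (- \<alpha>) * (exp (- x) * x powr (real n + \<alpha> - real (n - k))) = x ^ k"
    if "k \<le> n" for k
  proof -
    have "x powr (- \<alpha>) * x powr (real n + \<alpha> - real (n - k)) = x powr real k"
      using that by (simp add: powr_add[symmetric] of_nat_diff)
    thus ?thesis using assms by (simp add: powr_realpow exp_minus field_simps)
  qed
  have "exp x * x powr (- \<alpha>) / fact n *
      (\<Sum>k\<le>n. of_nat (n choose k) * (-1) ^ k * (fact (n - k) * ((real n + \<alpha>) gchoose (n - k))) *
       (exp (- x) * x powr (real n + \<alpha> - real (n - k))))
    = (\<Sum>k\<le>n. of_nat (n choose k) * (-1) ^ k * (fact (n - k) * ((real n + \<alpha>) gchoose (n - k))) / fact n *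
       (exp x * x powr (- \<alpha>) * (exp (- x) * x powr (real n + \<alpha> - real (n - k)))))"
    by (simp add: sum_distrib_left mult_ac)
  also have "\<dots> = (\<Sum>k\<le>n. ((real n + \<alpha>) gchoose (n - k)) * ((- x) ^ k / fact k))"
  proof (intro sum.cong refl)
    fix k assume "k \<in> {..n}"
    hence k: "k \<le> n" by simp
    show "of_nat (n choose k) * (-1) ^ k * (fact (n - k) * ((real n + \<alpha>) gchoose (n - k))) / fact n *
       (exp x * x powr (- \<alpha>) * (exp (- x) * x powr (real n + \<alpha> - real (n - k)))) =
       ((real n + \<alpha>) gchoose (n - k)) * ((- x) ^ k / fact k)"
      unfolding *[OF k] using k by (simp add: binomial_fact power_minus[of x])
  qed
  also have "\<dots> = laguerre \<alpha> n x"
    by (simp add: laguerre_def)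
  finally show ?thesis
    using deriv_iter_aux[OF assms] by simp
qed

definition wronskian :: "(complex \<Rightarrow> complex) list \<Rightarrow> complex \<Rightarrow> complex" where
  "wronskian fs x =
     Determinant.det (mat (length fs) (length fs) (\<lambda>(i, j). (deriv ^^ j) (fs ! i) x))"

definition is_partition :: "nat list \<Rightarrow> bool" where
  "is_partition lam \<longleftrightarrow> sorted_wrt (\<ge>) lam \<and> (\<forall>x\<in>set lam. 0 < x)"

text \<open>Lists are indexed from 0, so the part written \<open>\<lambda>\<^sub>j\<close> is \<open>lam ! (j - 1)\<close>.\<close>

definition shifted_part :: "nat list \<Rightarrow> nat \<Rightarrow> nat" where
  "shifted_part lam j = lam ! (j - 1) + length lam - j"

definition seed_functions :: "real \<Rightarrow> nat list \<Rightarrow> nat list \<Rightarrow> (complex \<Rightarrow> complex) list" where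
  "seed_functions \<alpha> lam mu =
     map (\<lambda>j x. laguerre \<alpha> (shifted_part lam j) x) [1..<Suc (length lam)] @
     map (\<lambda>j x. exp x * laguerre \<alpha> (shifted_part mu j) (- x)) [1..<Suc (length mu)]"

definition gen_laguerre_poly :: "real \<Rightarrow> nat list \<Rightarrow> nat list \<Rightarrow> complex poly" where
  "gen_laguerre_poly \<alpha> lam mu =
     (THE p. \<forall>x. poly p x =
        exp (- of_nat (length mu) * x) * wronskian (seed_functions \<alpha> lam mu) x)"

definition degree_seq :: "nat list \<Rightarrow> nat list \<Rightarrow> nat set" where
  "degree_seq lam mu =
     {n. int n \<ge> int (sum_list lam) + int (sum_list mu) - int (length lam) \<and>
         (\<forall>j\<in>{1..length lam}.
            int n - int (sum_list lam) - int (sum_list mu) \<noteq> int (lam ! (j - 1)) - int j)}"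

text \<open>The subtraction in the index is exact for \<open>n \<in> degree_seq lam mu\<close>.\<close>

definition exc_laguerre_poly :: "real \<Rightarrow> nat list \<Rightarrow> nat list \<Rightarrow> nat \<Rightarrow> complex poly" where
  "exc_laguerre_poly \<alpha> lam mu n =
     (THE p. \<forall>x. poly p x = exp (- of_nat (length mu) * x) *
        wronskian (seed_functions \<alpha> lam mu @
          [laguerre \<alpha> (n + length lam - (sum_list lam + sum_list mu))]) x)"

text \<open>\<open>p \<noteq> 0\<close> is needed because \<open>Polynomial.order z 0\<close> is unspecified.\<close>

definition simple_zero :: "complex poly \<Rightarrow> complex \<Rightarrow> bool" where
  "simple_zero p z \<longleftrightarrow> p \<noteq> 0 \<and> Polynomial.order z p = 1"

text \<open>The roots outside the open half-line \<open>(0, \<infinity>)\<close>, with multiplicity; 0 counts as exceptional.\<close>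

definition exceptional_zeros :: "real \<Rightarrow> nat list \<Rightarrow> nat list \<Rightarrow> nat \<Rightarrow> complex multiset" where
  "exceptional_zeros \<alpha> lam mu n =
     {#w \<in># proots (exc_laguerre_poly \<alpha> lam mu n). w \<notin> complex_of_real ` {0<..}#}"

text \<open>The two polynomials above are well defined: the functions on the right-hand sides are polynomial.\<close>

lemma exp_poly_deriv_iter:
  fixes f :: "complex \<Rightarrow> complex"
  assumes "f = (\<lambda>x. exp (c * x) * poly p x)"
  shows "\<exists>q. (deriv ^^ j) f = (\<lambda>x. exp (c * x) * poly q x)"
proof (induction j)
  case 0
  show ?case using assms by auto
next
  case (Suc j)
  then obtain q where q: "(deriv ^^ j) f = (\<lambda>x. exp (c * x) * poly q x)" by blast
  have "deriv (\<lambda>x. exp (c * x) * poly q x) x = exp (c * x) * poly (smult c q + pderiv q) x" for x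
    by (rule DERIV_imp_deriv) (auto intro!: derivative_eq_intros simp: algebra_simps)
  thus ?case using q by (auto intro!: exI[of _ "smult c q + pderiv q"])
qed

lemma wronskian_exp_poly:
  assumes "\<And>i. i < length fs \<Longrightarrow> fs ! i = (\<lambda>x. exp (c i * x) * poly (p i) x)"
  shows "\<exists>q. \<forall>x. wronskian fs x = exp ((\<Sum>i<length fs. c i) * x) * poly q x"
proof -
  let ?n = "length fs"
  have "\<forall>i j. \<exists>q. i < ?n \<longrightarrow> (deriv ^^ j) (fs ! i) = (\<lambda>x. exp (c i * x) * poly q x)"
    using exp_poly_deriv_iter[OF assms] by blast
  then obtain q where q: "\<And>i j. i < ?n \<Longrightarrow> (deriv ^^ j) (fs ! i) = (\<lambda>x. exp (c i * x) * poly (q i j) x)"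
    by metis
  have "wronskian fs x = exp ((\<Sum>i<?n. c i) * x) *
      poly (\<Sum>\<pi> | \<pi> permutes {0..<?n}. signof \<pi> * (\<Prod>i = 0..<?n. q i (\<pi> i))) x" for x
  proof -
    have "(\<Prod>i = 0..<?n. mat ?n ?n (\<lambda>(i, j). (deriv ^^ j) (fs ! i) x) $$ (i, \<pi> i)) =
        exp ((\<Sum>i<?n. c i) * x) * (\<Prod>i = 0..<?n. poly (q i (\<pi> i)) x)"
      if "\<pi> permutes {0..<?n}" for \<pi>
    proof -
      have "(\<Prod>i = 0..<?n. mat ?n ?n (\<lambda>(i, j). (deriv ^^ j) (fs ! i) x) $$ (i, \<pi> i)) =
         (\<Prod>i = 0..<?n. exp (c i * x) * poly (q i (\<pi> i)) x)"
        using that by (intro prod.cong refl) (auto simp: q permutes_in_image[OF that, simplified] dest: permutes_in_image[THEN iffD2, OF that])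
      also have "\<dots> = exp (\<Sum>i = 0..<?n. c i * x) * (\<Prod>i = 0..<?n. poly (q i (\<pi> i)) x)"
        by (simp add: prod.distrib exp_sum)
      finally show ?thesis by (simp add: sum_distrib_right atLeast0LessThan)
    qed
    thus ?thesis
      unfolding wronskian_def det_def
      by (auto simp: poly_sum poly_prod sum_distrib_left sign_def intro!: sum.cong)
  qed
  thus ?thesis by blast
qed

lemma laguerre_eq_poly: "\<exists>p. laguerre \<alpha> n = (poly p :: complex \<Rightarrow> complex)"
  by (rule exI[of _ "\<Sum>k\<le>n. smult (of_real ((real n + \<alpha>) gchoose (n - k)) / fact k) ([:0, -1:] ^ k)"])
     (auto simp: laguerre_def poly_sum fun_eq_iff)

lemma seed_functions_exp_poly:
  "\<exists>p. \<forall>i < length lam + length mu. seed_functions \<alpha> lam mu ! i =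
     (\<lambda>x. exp ((if i < length lam then 0 else 1) * x) * poly (p i) x)"
proof -
  obtain P :: "nat \<Rightarrow> complex poly" where P: "\<And>n. laguerre \<alpha> n = poly (P n)"
    using laguerre_eq_poly by metis
  show ?thesis
    by (rule exI[of _ "\<lambda>i. if i < length lam then P (shifted_part lam (i + 1))
          else P (shifted_part mu (i - length lam + 1)) \<circ>\<^sub>p [:0, -1:]"])
       (auto simp: seed_functions_def nth_append P poly_pcompose simp del: upt_Suc)
qed

lemma ex1_poly:
  fixes f :: "complex \<Rightarrow> complex"
  assumes "\<exists>p. \<forall>x. f x = poly p x"
  shows "\<exists>!p. \<forall>x. poly p x = f x"
proof -
  obtain p where "\<And>x. f x = poly p x" using assms by auto
  thus ?thesis by (metis poly_eq_poly_eq_iff ext)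
qed

lemma poly_gen_laguerre_poly:
  "poly (gen_laguerre_poly \<alpha> lam mu) x =
     exp (- of_nat (length mu) * x) * wronskian (seed_functions \<alpha> lam mu) x"
proof -
  let ?fs = "seed_functions \<alpha> lam mu" and ?c = "\<lambda>i. if i < length lam then 0 else 1 :: complex"
  have len: "length ?fs = length lam + length mu" by (simp add: seed_functions_def del: upt_Suc)
  have s: "(\<Sum>i<length lam + n. ?c i) = of_nat n" for n by (induction n) auto
  obtain p where "\<And>i. i < length ?fs \<Longrightarrow> ?fs ! i = (\<lambda>x. exp (?c i * x) * poly (p i) x)"
    using seed_functions_exp_poly[of lam mu \<alpha>] len by metis
  from wronskian_exp_poly[OF this] obtain q where
    "\<And>x. wronskian ?fs x = exp (of_nat (length mu) * x) * poly q x"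
    by (auto simp: len s)
  hence "\<exists>p. \<forall>x. exp (- of_nat (length mu) * x) * wronskian ?fs x = poly p x"
    by (intro exI[of _ q]) (simp add: exp_minus)
  from theI'[OF ex1_poly[OF this]] show ?thesis
    by (simp add: gen_laguerre_poly_def)
qed

lemma poly_exc_laguerre_poly:
  "poly (exc_laguerre_poly \<alpha> lam mu n) x =
     exp (- of_nat (length mu) * x) *
     wronskian (seed_functions \<alpha> lam mu @
       [laguerre \<alpha> (n + length lam - (sum_list lam + sum_list mu))]) x"
proof -
  let ?L = "laguerre \<alpha> (n + length lam - (sum_list lam + sum_list mu)) :: complex \<Rightarrow> complex"
  let ?r = "length lam + length mu"
  let ?fs = "seed_functions \<alpha> lam mu @ [?L]"
  let ?c = "\<lambda>i. if i < length lam then 0 else 1 :: complex"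
  let ?d = "\<lambda>i. if i < ?r then ?c i else 0"
  have len: "length (seed_functions \<alpha> lam mu) = ?r" by (simp add: seed_functions_def del: upt_Suc)
  have "(\<Sum>i<length lam + n. ?c i) = of_nat n" for n by (induction n) auto
  hence s: "(\<Sum>i<Suc ?r. ?d i) = of_nat (length mu)" by simp
  obtain p where p: "\<And>i. i < ?r \<Longrightarrow> seed_functions \<alpha> lam mu ! i = (\<lambda>x. exp (?c i * x) * poly (p i) x)"
    using seed_functions_exp_poly[of lam mu \<alpha>] by metis
  obtain P where P: "?L = poly P" using laguerre_eq_poly by metis
  have "?fs ! i = (\<lambda>x. exp (?d i * x) * poly (if i < ?r then p i else P) x)"
    if "i < length ?fs" for i
    using that p[of i] by (cases "i < ?r") (simp_all add: nth_append len P)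
  from wronskian_exp_poly[OF this] obtain q where
    "\<And>x. wronskian ?fs x = exp ((\<Sum>i<Suc ?r. ?d i) * x) * poly q x"
    by (auto simp: len)
  hence "\<And>x. wronskian ?fs x = exp (of_nat (length mu) * x) * poly q x"
    unfolding s by blast
  hence "\<exists>p. \<forall>x. exp (- of_nat (length mu) * x) * wronskian ?fs x = poly p x"
    by (intro exI[of _ q]) (simp add: exp_minus)
  from theI'[OF ex1_poly[OF this]] show ?thesis
    by (simp add: exc_laguerre_poly_def)
qed

end

theory Submission
  imports Defs "HOL-Complex_Analysis.Conformal_Mappings"
    "HOL-Computational_Algebra.Fundamental_Theorem_Algebra"
begin

text \<open>Expanding the Wronskian along its last row gives
  \<open>L\<^bsub>\<lambda>,\<mu>,n\<^esub> = \<Omega> Q\<^sub>r + \<Sum>\<^bsub>j<r\<^esub> C\<^sub>j Q\<^sub>j\<close>, where \<open>Q\<^sub>j\<close> is the \<open>j\<close>-th derivative of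
  \<open>L\<^sub>s\<^bsup>(\<alpha>)\<^esup>\<close> and the \<open>C\<^sub>j\<close> do not depend on \<open>n\<close>. Up to sign \<open>Q\<^sub>r\<close> is a Laguerre polynomial with
  parameter \<open>\<alpha> + r > -1\<close>, so its zeros are positive, and its logarithmic derivative off the half-line
  is \<open>O(\<surd>n)\<close> by the differential equation. The differentiated equation then gives
  \<open>Q\<^sub>j / Q\<^sub>r = O(1 / \<surd>n)\<close> for \<open>j < r\<close>, hence \<open>L\<^bsub>\<lambda>,\<mu>,n\<^esub> / Q\<^sub>r = \<Omega> + O(1 / \<surd>n)\<close> near \<open>z\<close>, and a
  Rouche-type argument on a circle of radius \<open>c / \<surd>n\<close> finds the zero.\<close>

section \<open>Laguerre polynomials\<close>

definition laguerre_poly :: "real \<Rightarrow> nat \<Rightarrow> complex poly" where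
  "laguerre_poly \<alpha> n =
     (\<Sum>k\<le>n. Polynomial.monom (of_real ((real n + \<alpha>) gchoose (n - k)) * ((-1) ^ k / fact k)) k)"

lemma poly_laguerre_poly: "poly (laguerre_poly \<alpha> n) = laguerre \<alpha> n"
proof
  show "poly (laguerre_poly \<alpha> n) x = laguerre \<alpha> n x" for x
    unfolding laguerre_poly_def laguerre_def poly_sum poly_monom power_minus[of x]
    by (simp add: mult_ac)
qed

lemma coeff_laguerre_poly:
  "poly.coeff (laguerre_poly \<alpha> n) k =
     (if k \<le> n then of_real ((real n + \<alpha>) gchoose (n - k)) * ((-1) ^ k / fact k) else 0)"
  by (simp add: laguerre_poly_def coeff_sum if_distrib[of "\<lambda>x. x * y" for y] sum.delta cong: if_cong)

lemma laguerre_poly_0 [simp]: "laguerre_poly \<alpha> 0 = 1"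
  by (simp add: laguerre_poly_def)

lemma laguerre_poly_nonzero [simp]: "laguerre_poly \<alpha> n \<noteq> 0"
proof
  assume "laguerre_poly \<alpha> n = 0"
  hence "poly.coeff (laguerre_poly \<alpha> n) n = 0" by simp
  thus False by (simp add: coeff_laguerre_poly)
qed

lemma pderiv_laguerre_poly_Suc:
  "pderiv (laguerre_poly \<alpha> (Suc n)) = - laguerre_poly (\<alpha> + 1) n"
proof (rule poly_eqI)
  fix k
  have "(1 + real n + \<alpha>) gchoose (n - k) = (real n + (\<alpha> + 1)) gchoose (n - k)"
    by (simp add: add_ac)
  thus "poly.coeff (pderiv (laguerre_poly \<alpha> (Suc n))) k = poly.coeff (- laguerre_poly (\<alpha> + 1) n) k"
    by (auto simp: coeff_pderiv coeff_laguerre_poly divide_simps simp del: of_nat_Suc)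
       (simp_all add: algebra_simps)
qed

text \<open>Each derivative lowers the degree by one, raises the parameter by one and flips the
  sign. With \<open>j = r\<close> the parameter becomes \<alpha> + r > -1, the range in which the
  zeros are shown to be positive, although \<alpha> itself may lie below it.\<close>

lemma funpow_pderiv_laguerre_poly:
  "(pderiv ^^ j) (laguerre_poly \<alpha> (j + n)) = smult ((-1) ^ j) (laguerre_poly (\<alpha> + real j) n)"
proof (induction j arbitrary: n)
  case (Suc j)
  show ?case
    using Suc.IH[of "Suc n"]
    by (simp add: pderiv_smult pderiv_laguerre_poly_Suc add_ac smult_minus_left smult_minus_right)
qed simp

lemma laguerre_poly_ode:
  "[:0, 1:] * pderiv (pderiv (laguerre_poly \<alpha> n)) + [:of_real (\<alpha> + 1), -1:] * pderiv (laguerre_poly \<alpha> n)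
     + smult (of_nat n) (laguerre_poly \<alpha> n) = 0"
proof (rule poly_eqI)
  fix k
  let ?c = "poly.coeff (laguerre_poly \<alpha> n)"
  \<comment> \<open>The coefficient of \<open>x ^ k\<close> in Laguerre's equation: the factor
    \<alpha> + 1 + k collects the contributions of x y'' and (\<alpha> + 1) y', and n - k those of -
    x y' and n y.\<close>
  have rec: "of_nat (Suc k) * (of_real (\<alpha> + 1) + of_nat k) * ?c (Suc k) + (of_nat n - of_nat k) * ?c k = 0"
  proof (cases "k < n")
    case True
    define m where "m = n - Suc k"
    have n: "n - k = Suc m" "n = Suc k + m" using True by (auto simp: m_def)
    have "of_nat (Suc m) * ((real n + \<alpha>) gchoose Suc m) = (real n + \<alpha> - of_nat m) * ((real n + \<alpha>) gchoose m)"
      using gbinomial_mult_1[of "real n + \<alpha>" m] by (simp add: algebra_simps)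
    also have "real n + \<alpha> - of_nat m = \<alpha> + 1 + of_nat k" by (simp add: n)
    finally have "complex_of_real (of_nat (Suc m) * ((real n + \<alpha>) gchoose Suc m)) =
        of_real ((\<alpha> + 1 + of_nat k) * ((real n + \<alpha>) gchoose m))" by (rule arg_cong)
    hence *: "of_nat (Suc m) * complex_of_real ((real n + \<alpha>) gchoose Suc m) =
        (of_real (\<alpha> + 1) + of_nat k) * of_real ((real n + \<alpha>) gchoose m)"
      by (simp only: of_real_mult of_real_add of_real_of_nat_eq)
    have c: "?c k = of_real ((real n + \<alpha>) gchoose Suc m) * ((-1) ^ k / fact k)"
      "of_nat (Suc k) * ?c (Suc k) = - of_real ((real n + \<alpha>) gchoose m) * ((-1) ^ k / fact k)"
      using True n(1) by (simp_all add: coeff_laguerre_poly m_def del: of_nat_Suc)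
    have "of_nat n - of_nat k = (of_nat (Suc m) :: complex)" by (simp add: n)
    moreover have "of_nat (Suc k) * (of_real (\<alpha> + 1) + of_nat k) * ?c (Suc k) =
        (of_real (\<alpha> + 1) + of_nat k) * (of_nat (Suc k) * ?c (Suc k))" by (simp only: mult_ac)
    ultimately show ?thesis
      unfolding c by (simp only: mult.assoc[symmetric] *) simp
  next
    case False
    thus ?thesis by (auto simp: coeff_laguerre_poly)
  qed
  show "poly.coeff ([:0, 1:] * pderiv (pderiv (laguerre_poly \<alpha> n)) + [:of_real (\<alpha> + 1), -1:] * pderiv (laguerre_poly \<alpha> n)
     + smult (of_nat n) (laguerre_poly \<alpha> n)) k = poly.coeff 0 k"
  proof (cases k)
    case 0
    thus ?thesis using rec by (simp add: coeff_pderiv)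
  next
    case (Suc i)
    thus ?thesis using rec by (simp add: coeff_pderiv algebra_simps)
  qed
qed

text \<open>This is Laguerre's equation for degree n + 1 with the derivatives rewritten as Laguerre
  polynomials of parameter \<alpha> + 1. It builds degree n + 1 from degree n by a first-order
  operator, which drives the induction for positivity of the zeros.\<close>

lemma laguerre_poly_raise:
  "[:0, 1:] * pderiv (laguerre_poly (\<alpha> + 1) n) + [:of_real (\<alpha> + 1), -1:] * laguerre_poly (\<alpha> + 1) n
     = smult (of_nat (Suc n)) (laguerre_poly \<alpha> (Suc n))"
proof -
  have *: "P + R = Y" if "- P + - R + Y = 0" for P R Y :: "complex poly"
    using that by (metis add_eq_0_iff minus_add_distrib minus_minus)
  show ?thesis
    by (rule *) (use laguerre_poly_ode[of \<alpha> "Suc n"] in \<open>simp only: pderiv_laguerre_poly_Suc pderiv_minus mult_minus_right\<close>)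
qed

text \<open>By the Leibniz rule, differentiating x y'' + (c - x) y' + a y replaces c by c + 1 and a
  by a - 1. For fixed j the factor n - j in front of \<open>Q j\<close> is large, which makes the
  low derivatives small.\<close>

lemma funpow_pderiv_laguerre_poly_ode:
  fixes \<alpha> :: real and n :: nat
  defines "Q \<equiv> \<lambda>j. (pderiv ^^ j) (laguerre_poly \<alpha> n)"
  shows "[:0, 1:] * Q (Suc (Suc j)) + [:of_real \<alpha> + of_nat j + 1, -1:] * Q (Suc j)
     + smult (of_nat n - of_nat j) (Q j) = 0"
proof (induction j)
  case 0
  show ?case using laguerre_poly_ode[of \<alpha> n] by (simp add: Q_def)
next
  case (Suc j)
  have Q: "pderiv (Q i) = Q (Suc i)" for i by (simp add: Q_def)
  show ?case
  proof (rule poly_eq_poly_eq_iff[THEN iffD1, OF ext])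
    fix x
    have "poly (pderiv ([:0, 1:] * Q (Suc (Suc j)) + [:of_real \<alpha> + of_nat j + 1, -1:] * Q (Suc j)
       + smult (of_nat n - of_nat j) (Q j))) x = 0"
      unfolding Suc.IH by simp
    thus "poly ([:0, 1:] * Q (Suc (Suc (Suc j))) + [:of_real \<alpha> + of_nat (Suc j) + 1, -1:] * Q (Suc (Suc j))
       + smult (of_nat n - of_nat (Suc j)) (Q (Suc j))) x = poly 0 x"
      unfolding pderiv_add pderiv_mult pderiv_smult Q
      by (simp add: pderiv_pCons algebra_simps)
  qed
qed

section \<open>Logarithmic derivatives\<close>

text \<open>With S = p'/p, the second formula is p''/p = S^2 + S'. The multiset lets repeated roots
  count with their multiplicity.\<close>

lemma pderiv_prod_linear:
  fixes x :: "'a :: field_char_0"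
  assumes "x \<notin># A"
  defines "p \<equiv> \<Prod>a\<in>#A. [:-a, 1:]"
  shows "poly (pderiv p) x = poly p x * (\<Sum>a\<in>#A. 1 / (x - a))"
    and "poly (pderiv (pderiv p)) x =
           poly p x * ((\<Sum>a\<in>#A. 1 / (x - a))\<^sup>2 - (\<Sum>a\<in>#A. 1 / (x - a)\<^sup>2))"
proof -
  have "poly (pderiv (\<Prod>a\<in>#A. [:-a, 1:])) x = poly (\<Prod>a\<in>#A. [:-a, 1:]) x * (\<Sum>a\<in>#A. 1 / (x - a)) \<and>
    poly (pderiv (pderiv (\<Prod>a\<in>#A. [:-a, 1:]))) x =
           poly (\<Prod>a\<in>#A. [:-a, 1:]) x * ((\<Sum>a\<in>#A. 1 / (x - a))\<^sup>2 - (\<Sum>a\<in>#A. 1 / (x - a)\<^sup>2))"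
    using assms(1)
  proof (induction A)
    case (add b A)
    define q where "q = (\<Prod>a\<in>#A. [:-a, 1:])"
    define S where "S = (\<Sum>a\<in>#A. 1 / (x - a))"
    define T where "T = (\<Sum>a\<in>#A. 1 / (x - a)\<^sup>2)"
    have IH: "poly (pderiv q) x = poly q x * S" "poly (pderiv (pderiv q)) x = poly q x * (S\<^sup>2 - T)"
      using add by (auto simp: q_def S_def T_def)
    have nz: "x - b \<noteq> 0" using add.prems by auto
    have d: "pderiv [:-b, 1:] = 1" by (simp add: pderiv_pCons)
    have p: "(\<Prod>a\<in>#add_mset b A. [:-a, 1:]) = [:-b, 1:] * q" by (simp add: q_def)
    have sums: "(\<Sum>a\<in>#add_mset b A. 1 / (x - a)) = 1 / (x - b) + S"
      "(\<Sum>a\<in>#add_mset b A. 1 / (x - a)\<^sup>2) = 1 / (x - b)\<^sup>2 + T" by (simp_all add: S_def T_def)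
    have e0: "poly ([:-b, 1:] * q) x = (x - b) * poly q x" by (simp add: algebra_simps)
    have e1: "poly (pderiv ([:-b, 1:] * q)) x = poly q x * (1 + (x - b) * S)"
      unfolding pderiv_mult d poly_add poly_mult IH by (simp add: algebra_simps)
    have e2: "poly (pderiv (pderiv ([:-b, 1:] * q))) x = poly q x * (2 * S + (x - b) * (S\<^sup>2 - T))"
      unfolding pderiv_mult pderiv_add d poly_add poly_mult IH by (simp add: algebra_simps)
    have "u * (1 + y * S) = y * u * (1 / y + S)"
      "u * (2 * S + y * (S\<^sup>2 - T)) = y * u * ((1 / y + S)\<^sup>2 - (1 / y\<^sup>2 + T))" if "y \<noteq> 0" for u y
      using that by (simp_all add: field_simps power2_eq_square)
    thus ?case
      unfolding p sums e0 e1 e2 using nz by blast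
  qed simp
  thus "poly (pderiv p) x = poly p x * (\<Sum>a\<in>#A. 1 / (x - a))"
    and "poly (pderiv (pderiv p)) x =
           poly p x * ((\<Sum>a\<in>#A. 1 / (x - a))\<^sup>2 - (\<Sum>a\<in>#A. 1 / (x - a)\<^sup>2))"
    by (simp_all add: p_def)
qed

lemma pderiv_eq_sum_proots:
  fixes p :: "complex poly"
  assumes "poly p x \<noteq> 0"
  shows "poly (pderiv p) x = poly p x * (\<Sum>a\<in>#proots p. 1 / (x - a))"
    and "poly (pderiv (pderiv p)) x =
           poly p x * ((\<Sum>a\<in>#proots p. 1 / (x - a))\<^sup>2 - (\<Sum>a\<in>#proots p. 1 / (x - a)\<^sup>2))"
proof -
  let ?q = "\<Prod>a\<in>#proots p. [:-a, 1:]"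
  have "x \<notin># proots p" using assms by (cases "p = 0") auto
  note q = pderiv_prod_linear[OF this]
  have p: "smult (lead_coeff p) ?q = p" by (rule complex_poly_decompose_multiset)
  have 0: "poly p x = lead_coeff p * poly ?q x"
    by (subst (1) p [symmetric]) simp
  have 1: "poly (pderiv p) x = lead_coeff p * poly (pderiv ?q) x"
    by (subst (1) p [symmetric]) (simp add: pderiv_smult)
  have 2: "poly (pderiv (pderiv p)) x = lead_coeff p * poly (pderiv (pderiv ?q)) x"
    by (subst (1) p [symmetric]) (simp add: pderiv_smult)
  show "poly (pderiv p) x = poly p x * (\<Sum>a\<in>#proots p. 1 / (x - a))"
    and "poly (pderiv (pderiv p)) x =
           poly p x * ((\<Sum>a\<in>#proots p. 1 / (x - a))\<^sup>2 - (\<Sum>a\<in>#proots p. 1 / (x - a)\<^sup>2))"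
    unfolding 0 1 2 q by (simp_all only: mult.assoc)
qed

section \<open>Positivity of the zeros\<close>

abbreviation pos_reals :: "complex set" where "pos_reals \<equiv> of_real ` {0<..}"

text \<open>For t > 0 the imaginary part of x / (x - t) is - t Im x / |x - t|^2, so its sign is
  opposite to that of Im x. The factor \<open>Im x\<close> treats both half-planes at once.\<close>

lemma sum_x_over_x_minus_pos:
  assumes "set_mset A \<subseteq> pos_reals"
  shows "Im x * Im (\<Sum>a\<in>#A. x / (x - a)) \<le> 0"
    and "Im x = 0 \<Longrightarrow> Re x \<le> 0 \<Longrightarrow> Re (\<Sum>a\<in>#A. x / (x - a)) \<ge> 0"
proof -
  have 1: "Im x * Im (x / (x - of_real t)) \<le> 0" if "t > 0" for t
  proof -
    have "Im x * Im (x / (x - of_real t)) = - (t * (Im x)\<^sup>2) / ((Re x - t)\<^sup>2 + (Im x)\<^sup>2)"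
      by (simp add: Im_divide field_simps power2_eq_square)
    also have "\<dots> \<le> 0" using that by (intro divide_nonpos_nonneg) auto
    finally show ?thesis .
  qed
  have 2: "Re (x / (x - of_real t)) \<ge> 0" if "t > 0" "Im x = 0" "Re x \<le> 0" for t
    using that by (simp add: Re_divide) (intro divide_nonneg_nonneg mult_nonpos_nonpos; simp)
  show "Im x * Im (\<Sum>a\<in>#A. x / (x - a)) \<le> 0"
    using assms
  proof (induction A)
    case (add a A)
    then obtain t where "t > 0" "a = of_real t" by auto
    thus ?case using add 1[of t] by (simp add: distrib_left)
  qed simp
  show "Re (\<Sum>a\<in>#A. x / (x - a)) \<ge> 0" if "Im x = 0" "Re x \<le> 0"
    using assms
  proof (induction A)
    case (add a A)
    then obtain t where "t > 0" "a = of_real t" by auto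
    thus ?case using add 2[of t] that by simp
  qed simp
qed

text \<open>Dividing by \<open>p\<close> gives \<open>c - x + \<Sum> x / (x - a)\<close>; off the real axis the imaginary parts of
  \<open>- x\<close> and of all the \<open>x / (x - a)\<close> have the same sign, and for real \<open>x \<le> 0\<close> all terms are
  nonnegative.\<close>

lemma raising_operator_pos_zeros:
  assumes "p \<noteq> 0" and p: "\<And>x. poly p x = 0 \<Longrightarrow> x \<in> pos_reals" and "c > 0"
    and zero: "poly ([:0, 1:] * pderiv p + [:of_real c, -1:] * p) x = 0"
  shows "x \<in> pos_reals"
proof (rule ccontr)
  assume x: "x \<notin> pos_reals"
  have A: "set_mset (proots p) \<subseteq> pos_reals" using p assms(1) by auto
  define S where "S = (\<Sum>a\<in>#proots p. x / (x - a))"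
  have px: "poly p x \<noteq> 0" using p x by blast
  have "x * (\<Sum>a\<in>#proots p. 1 / (x - a)) = S"
    unfolding S_def sum_mset_distrib_left by simp
  hence "x * poly (pderiv p) x = S * poly p x"
    using pderiv_eq_sum_proots(1)[OF px] by (metis mult.assoc mult.commute)
  hence "(S + of_real c - x) * poly p x = 0"
    using zero by (simp add: algebra_simps)
  hence S: "S = x - of_real c" using px by (simp add: eq_diff_eq)
  \<comment> \<open>As c is real, \<open>S = x - c\<close> has the same imaginary part as x, so the
    sign condition forces x to be real.\<close>
  have "(Im x)\<^sup>2 \<le> 0"
    using sum_x_over_x_minus_pos(1)[OF A, of x] unfolding S_def[symmetric] S by (simp add: power2_eq_square)
  hence im: "Im x = 0" by simp
  hence "x = of_real (Re x)" by (simp add: complex_eq_iff)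
  hence re: "Re x \<le> 0" using x by (metis greaterThan_iff image_eqI not_le)
  from sum_x_over_x_minus_pos(2)[OF A im re] have "Re x \<ge> c"
    unfolding S_def[symmetric] S by simp
  thus False using re \<open>c > 0\<close> by simp
qed

text \<open>The induction on the degree replaces the usual orthogonality argument. The raising
  operator lowers the parameter from \<alpha> + 1 to \<alpha>, and its constant is \<alpha> + 1,
  positive exactly when \<alpha> > -1.\<close>

lemma laguerre_poly_pos_zeros:
  assumes "\<alpha> > -1" "poly (laguerre_poly \<alpha> n) x = 0"
  shows "x \<in> pos_reals"
  using assms
proof (induction n arbitrary: \<alpha> x)
  case (Suc n)
  show ?case
  proof (rule raising_operator_pos_zeros)
    show "laguerre_poly (\<alpha> + 1) n \<noteq> 0" "\<alpha> + 1 > 0" using Suc.prems by simp_all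
    show "y \<in> pos_reals" if "poly (laguerre_poly (\<alpha> + 1) n) y = 0" for y
      using Suc.IH[OF _ that] Suc.prems by simp
    show "poly ([:0, 1:] * pderiv (laguerre_poly (\<alpha> + 1) n) +
        [:of_real (\<alpha> + 1), -1:] * laguerre_poly (\<alpha> + 1) n) x = 0"
      unfolding laguerre_poly_raise using Suc.prems by simp
  qed
qed simp

section \<open>Growth of the derivatives off the positive half-line\<close>

text \<open>The point -1 serves as a reference: there every summand is real, all have the same sign,
  and 1 / (1 + t)^2 is at most 1 / (1 + t). The last claim carries the bound from -1 to other points
  x at the cost of the factor \<open>B\<close>.\<close>

lemma proots_sums_at_minus_one:
  assumes "set_mset A \<subseteq> pos_reals"
  defines "w \<equiv> \<Sum>a\<in>#A. 1 / (1 + Re a)"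
  shows "(\<Sum>a\<in>#A. 1 / (-1 - a)) = - of_real w" and "w \<ge> 0"
    and "\<exists>v\<le>w. (\<Sum>a\<in>#A. 1 / (-1 - a)\<^sup>2) = of_real v"
    and "(\<And>t. t \<ge> 0 \<Longrightarrow> 1 + t \<le> B * cmod (x - of_real t)) \<Longrightarrow> cmod (\<Sum>a\<in>#A. 1 / (x - a)) \<le> B * w"
proof -
  let ?w = "\<lambda>A. \<Sum>a\<in>#A. 1 / (1 + Re a)"
  have 1: "(\<Sum>a\<in>#A. 1 / (-1 - a)) = - of_real (?w A) \<and> ?w A \<ge> 0"
    using assms(1)
  proof (induction A)
    case (add a A)
    then obtain t where t: "t > 0" "a = of_real t" by auto
    have "1 / (-1 - complex_of_real t) = - of_real (1 / (1 + t))"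
      using t by (simp add: field_simps complex_eq_iff)
    thus ?case using add t by simp
  qed simp
  thus "(\<Sum>a\<in>#A. 1 / (-1 - a)) = - of_real w" "w \<ge> 0"
    by (auto simp: w_def)
  show "\<exists>v\<le>w. (\<Sum>a\<in>#A. 1 / (-1 - a)\<^sup>2) = of_real v"
    unfolding w_def using assms(1)
  proof (induction A)
    case (add a A)
    then obtain t where t: "t > 0" "a = of_real t" by auto
    from add obtain v where v: "v \<le> ?w A" "(\<Sum>a\<in>#A. 1 / (-1 - a)\<^sup>2) = of_real v" by auto
    have "(-1 - complex_of_real t)\<^sup>2 = of_real ((1 + t)\<^sup>2)"
      by (simp add: power2_eq_square algebra_simps)
    hence "1 / (-1 - a)\<^sup>2 = of_real (1 / (1 + t)\<^sup>2)"
      unfolding t by simp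
    moreover have "1 / (1 + t)\<^sup>2 \<le> 1 / (1 + t)"
      using t by (simp add: divide_simps power2_eq_square)
    ultimately show ?case using v t
      by (intro exI[of _ "1 / (1 + t)\<^sup>2 + v"]) auto
  qed simp
  show "cmod (\<Sum>a\<in>#A. 1 / (x - a)) \<le> B * w" if B: "\<And>t. t \<ge> 0 \<Longrightarrow> 1 + t \<le> B * cmod (x - of_real t)"
    unfolding w_def using assms(1)
  proof (induction A)
    case (add a A)
    then obtain t where t: "t > 0" "a = of_real t" by auto
    have bt: "1 + t \<le> B * cmod (x - of_real t)" using B[of t] t by simp
    hence "cmod (x - of_real t) \<noteq> 0" using t by force
    hence "cmod (x - of_real t) > 0" by simp
    hence "cmod (1 / (x - a)) \<le> B * (1 / (1 + t))"
      using bt t by (simp add: norm_divide field_simps)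
    moreover have "cmod (\<Sum>a\<in>#A. 1 / (x - a)) \<le> B * ?w A" using add by simp
    ultimately show ?case
      using t norm_triangle_ineq[of "1 / (x - a)" "\<Sum>a\<in>#A. 1 / (x - a)"] by (simp add: distrib_left)
  qed simp
qed

text \<open>Every \<open>|1 / (x - a)|\<close> is comparable with \<open>1 / (1 + a)\<close>, and the sum \<open>w\<close> of the latter is minus
  the logarithmic derivative at \<open>-1\<close>. There the differential equation becomes a Riccati equation
  that yields \<open>w\<^sup>2 \<le> n\<close>.\<close>

lemma laguerre_poly_log_deriv_bound:
  assumes "\<beta> > -1" and B: "\<And>t. t \<ge> 0 \<Longrightarrow> 1 + t \<le> B * cmod (x - of_real t)"
  shows "cmod (poly (pderiv (laguerre_poly \<beta> n)) x) \<le> B * sqrt n * cmod (poly (laguerre_poly \<beta> n) x)"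
proof -
  let ?p = "laguerre_poly \<beta> n"
  define A where "A = proots ?p"
  define w where "w = (\<Sum>a\<in>#A. 1 / (1 + Re a))"
  have A: "set_mset A \<subseteq> pos_reals"
    using laguerre_poly_pos_zeros[OF assms(1)] by (auto simp: A_def)
  obtain v where v: "v \<le> w" "(\<Sum>a\<in>#A. 1 / (-1 - a)\<^sup>2) = of_real v"
    using proots_sums_at_minus_one(3)[OF A] by (auto simp: w_def)
  have w: "(\<Sum>a\<in>#A. 1 / (-1 - a)) = - of_real w" "w \<ge> 0"
    using proots_sums_at_minus_one(1,2)[OF A] by (auto simp: w_def)
  have nz: "poly ?p (-1) \<noteq> 0"
  proof
    assume "poly ?p (-1) = 0"
    from laguerre_poly_pos_zeros[OF assms(1) this] show False
      by (auto simp: complex_eq_iff)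
  qed
  note d = pderiv_eq_sum_proots[OF nz, folded A_def, unfolded w v]
  have "poly ([:0, 1:] * pderiv (pderiv ?p) + [:of_real (\<beta> + 1), -1:] * pderiv ?p
     + smult (of_nat n) ?p) (-1) = 0"
    unfolding laguerre_poly_ode by simp
  hence "poly ?p (-1) * (- (of_real w ^ 2 - of_real v) - (of_real \<beta> + 2) * of_real w + of_nat n) = 0"
    by (simp add: d algebra_simps)
  hence "- (of_real w ^ 2 - of_real v) - (of_real \<beta> + 2) * of_real w + of_nat n = (0 :: complex)"
    using nz by simp
  hence "complex_of_real (- (w ^ 2 - v) - (\<beta> + 2) * w + real n) = of_real 0" by simp
  hence "- (w ^ 2 - v) - (\<beta> + 2) * w + real n = 0" by (simp only: of_real_eq_iff)
  \<comment> \<open>Since v \<le> w, the equation gives w^2 = n + v - (\<beta> + 2) w \<le> n -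
    (\<beta> + 1) w.\<close>
  moreover have "(\<beta> + 1) * w \<ge> 0" using assms(1) w by simp
  ultimately have "w ^ 2 \<le> real n" using v(1) by (simp add: algebra_simps)
  hence wn: "w \<le> sqrt n" using real_le_rsqrt by blast
  have B0: "B \<ge> 0"
  proof (rule ccontr)
    assume "\<not> B \<ge> 0"
    hence "B * cmod x \<le> 0" by (simp add: mult_nonpos_nonneg)
    thus False using B[of 0] by simp
  qed
  have "poly ?p x \<noteq> 0"
  proof
    assume "poly ?p x = 0"
    then obtain t where "t > 0" "x = of_real t" using laguerre_poly_pos_zeros[OF assms(1)] by blast
    thus False using B[of t] by simp
  qed
  from pderiv_eq_sum_proots(1)[OF this]
  have "cmod (poly (pderiv ?p) x) = cmod (poly ?p x) * cmod (\<Sum>a\<in>#A. 1 / (x - a))"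
    by (simp only: A_def norm_mult)
  also have "\<dots> \<le> cmod (poly ?p x) * (B * w)"
    using proots_sums_at_minus_one(4)[OF A B] by (intro mult_left_mono) (auto simp: w_def)
  also have "\<dots> \<le> cmod (poly ?p x) * (B * sqrt n)"
    using B0 wn by (intro mult_left_mono) auto
  finally show ?thesis by (simp add: mult_ac)
qed

text \<open>Read backwards, the differential equation expresses \<open>Q j\<close> by \<open>Q (j + 1)\<close> and \<open>Q (j + 2)\<close>
  with a gain of a factor \<open>1 / s\<close>.\<close>

lemma laguerre_poly_deriv_step:
  fixes \<alpha> :: real and s j r :: nat and x :: complex
  defines "Q \<equiv> \<lambda>j. poly ((pderiv ^^ j) (laguerre_poly \<alpha> s)) x"
  assumes s: "s \<ge> 2 * r + 2" and j: "j < r" and x: "cmod x \<le> M"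
    and K1: "cmod (Q (Suc j)) \<le> K1 * sqrt s * q"
    and K2: "cmod (Q (Suc (Suc j))) \<le> K2 * sqrt s * q"
  shows "cmod (Q j) \<le> 2 * (M * K2 + (\<bar>\<alpha>\<bar> + real r + 1 + M) * K1) / sqrt s * q"
proof -
  let ?u = "of_real \<alpha> + of_nat j + 1 - x"
  have "poly ([:0, 1:] * (pderiv ^^ (Suc (Suc j))) (laguerre_poly \<alpha> s)
     + [:of_real \<alpha> + of_nat j + 1, -1:] * (pderiv ^^ (Suc j)) (laguerre_poly \<alpha> s)
     + smult (of_nat s - of_nat j) ((pderiv ^^ j) (laguerre_poly \<alpha> s))) x = 0"
    unfolding funpow_pderiv_laguerre_poly_ode by simp
  hence "x * Q (Suc (Suc j)) + ?u * Q (Suc j) + (of_nat s - of_nat j) * Q j = 0"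
    by (simp add: Q_def algebra_simps del: funpow.simps)
  hence eq: "of_nat (s - j) * Q j = - (x * Q (Suc (Suc j)) + ?u * Q (Suc j))"
    using s j by (simp add: of_nat_diff add_eq_0_iff)
  have u: "cmod ?u \<le> \<bar>\<alpha>\<bar> + real r + 1 + M"
  proof -
    have "cmod ?u \<le> cmod (of_real (\<alpha> + real j + 1)) + cmod x"
      using norm_triangle_ineq4[of "of_real (\<alpha> + real j + 1)" x] by simp
    also have "cmod (of_real (\<alpha> + real j + 1)) \<le> \<bar>\<alpha>\<bar> + real r + 1"
      unfolding norm_of_real using j by linarith
    finally show ?thesis using x by simp
  qed
  have "real (s - j) * cmod (Q j) = cmod (of_nat (s - j) * Q j)"
    by (simp add: norm_mult)
  also have "\<dots> = cmod (x * Q (Suc (Suc j)) + ?u * Q (Suc j))"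
    unfolding eq by (rule norm_minus_cancel)
  also have "\<dots> \<le> cmod x * cmod (Q (Suc (Suc j))) + cmod ?u * cmod (Q (Suc j))"
    by (metis norm_mult norm_triangle_ineq)
  also have "\<dots> \<le> M * (K2 * sqrt s * q) + (\<bar>\<alpha>\<bar> + real r + 1 + M) * (K1 * sqrt s * q)"
    using x u K1 K2 by (intro add_mono mult_mono) (auto intro: order_trans[OF norm_ge_zero])
  also have "\<dots> = (M * K2 + (\<bar>\<alpha>\<bar> + real r + 1 + M) * K1) * sqrt s * q"
    by (simp add: algebra_simps)
  finally have *: "real (s - j) * cmod (Q j) \<le> (M * K2 + (\<bar>\<alpha>\<bar> + real r + 1 + M) * K1) * sqrt s * q" .
  \<comment> \<open>From \<open>s \<ge> 2 * r + 2\<close> and \<open>j < r\<close> follows s \<le> 2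
    (s - j); this is the origin of the factor 2 in the bound.\<close>
  have "(sqrt s * sqrt s) * cmod (Q j) \<le> 2 * real (s - j) * cmod (Q j)"
    using s j by (intro mult_right_mono) auto
  also note mult_left_mono[OF *, of 2, simplified mult.assoc[symmetric]]
  finally have "sqrt s * (sqrt s * cmod (Q j)) \<le>
      sqrt s * (2 * (M * K2 + (\<bar>\<alpha>\<bar> + real r + 1 + M) * K1) * q)"
    by (simp only: mult_ac)
  moreover have "sqrt s > 0" using s by simp
  ultimately have "sqrt s * cmod (Q j) \<le> 2 * (M * K2 + (\<bar>\<alpha>\<bar> + real r + 1 + M) * K1) * q"
    by (rule mult_left_le_imp_le)
  thus ?thesis using \<open>sqrt s > 0\<close> by (simp add: pos_le_divide_eq mult.commute)
qed

text \<open>Descending induction on j, starting from the orders r + 1 and r. The predicate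
  \<open>good\<close> collects what is uniform near the zero, so that K depends on neither s nor x;
  its last clause also keeps x off the half-line.\<close>

lemma laguerre_poly_derivs_bound:
  fixes \<alpha> M B :: real and r :: nat
  assumes "\<alpha> + real r > -1"
  defines "good \<equiv> \<lambda>(s :: nat) x. s \<ge> 2 * r + 2 \<and> cmod x \<le> M \<and>
             (\<forall>t\<ge>0. 1 + t \<le> B * cmod (x - complex_of_real t))"
    and "Q \<equiv> \<lambda>s j x. poly ((pderiv ^^ j) (laguerre_poly \<alpha> s)) x"
  shows "\<exists>K\<ge>0. \<forall>s x. \<forall>j<r. good s x \<longrightarrow> cmod (Q s j x) \<le> K / sqrt s * cmod (Q s r x)"
    and "good s x \<Longrightarrow> Q s r x \<noteq> 0"
proof -
  have Qr: "(pderiv ^^ r) (laguerre_poly \<alpha> s) = smult ((-1) ^ r) (laguerre_poly (\<alpha> + real r) (s - r))"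
    if "good s x" for s x
    using funpow_pderiv_laguerre_poly[of r \<alpha> "s - r"] that by (simp add: good_def)
  show "Q s r x \<noteq> 0" if good: "good s x" for s x
  proof
    assume "Q s r x = 0"
    hence "poly (laguerre_poly (\<alpha> + real r) (s - r)) x = 0"
      unfolding Q_def Qr[OF good] by simp
    then obtain t where "t > 0" "x = of_real t"
      using laguerre_poly_pos_zeros[OF assms(1)] by blast
    thus False using good unfolding good_def by (auto dest!: spec[of _ t])
  qed
  \<comment> \<open>The weak growth rate \<open>sqrt s\<close> is the one the logarithmic derivative
    gives at order r + 1. The recurrence turns it into 1 / \<open>sqrt s\<close> below r, and
    \<open>weaken\<close> returns to \<open>P\<close> for the next step.\<close>
  define P where "P j \<longleftrightarrow> (\<exists>K. \<forall>s x. good s x \<longrightarrow> cmod (Q s j x) \<le> K * sqrt s * cmod (Q s r x))" for j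
  have P_r: "P r"
    unfolding P_def
  proof (intro exI[of _ 1] allI impI)
    fix s x assume "good s x"
    hence "1 \<le> sqrt (real s)" by (auto simp: good_def)
    hence "1 * cmod (Q s r x) \<le> sqrt s * cmod (Q s r x)" by (intro mult_right_mono) auto
    thus "cmod (Q s r x) \<le> 1 * sqrt s * cmod (Q s r x)" by simp
  qed
  \<comment> \<open>The quotient of the derivatives of orders r + 1 and r is the logarithmic
    derivative of a Laguerre polynomial of parameter \<alpha> + r. The absolute value is taken
    because \<open>B\<close> is known to be nonnegative only when a good point exists.\<close>
  have P_Suc_r: "P (Suc r)"
    unfolding P_def
  proof (intro exI[of _ "\<bar>B\<bar>"] allI impI)
    fix s x assume good: "good s x"
    have "cmod (Q s (Suc r) x) \<le> B * sqrt (s - r) * cmod (Q s r x)"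
      unfolding Q_def funpow.simps o_def Qr[OF good] pderiv_smult poly_smult norm_mult
      using laguerre_poly_log_deriv_bound[OF assms(1), of B x "s - r"] good
      by (simp add: good_def norm_power)
    also have "\<dots> \<le> \<bar>B\<bar> * sqrt s * cmod (Q s r x)"
      by (intro mult_right_mono mult_mono) auto
    finally show "cmod (Q s (Suc r) x) \<le> \<bar>B\<bar> * sqrt s * cmod (Q s r x)" .
  qed
  have step: "\<exists>K. \<forall>s x. good s x \<longrightarrow> cmod (Q s j x) \<le> K / sqrt s * cmod (Q s r x)"
    if "j < r" "P (Suc j)" "P (Suc (Suc j))" for j
  proof -
    obtain K1 K2 where "\<And>s x. good s x \<Longrightarrow> cmod (Q s (Suc j) x) \<le> K1 * sqrt s * cmod (Q s r x)"
      "\<And>s x. good s x \<Longrightarrow> cmod (Q s (Suc (Suc j)) x) \<le> K2 * sqrt s * cmod (Q s r x)"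
      using \<open>P (Suc j)\<close> \<open>P (Suc (Suc j))\<close> unfolding P_def by blast
    thus ?thesis
      using laguerre_poly_deriv_step[where r = r and j = j and M = M and ?K1.0 = K1 and ?K2.0 = K2 and \<alpha> = \<alpha>] \<open>j < r\<close>
      unfolding Q_def by (meson good_def)
  qed
  have weaken: "P j" if "\<exists>K. \<forall>s x. good s x \<longrightarrow> cmod (Q s j x) \<le> K / sqrt s * cmod (Q s r x)" for j
  proof -
    from that obtain K where K: "\<And>s x. good s x \<Longrightarrow> cmod (Q s j x) \<le> K / sqrt s * cmod (Q s r x)" by blast
    have "cmod (Q s j x) \<le> \<bar>K\<bar> * sqrt s * cmod (Q s r x)" if good: "good s x" for s x
    proof -
      have "real s \<ge> 1" using good by (auto simp: good_def)
      hence "sqrt s \<ge> 1" by simp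
      hence "K / sqrt s \<le> \<bar>K\<bar> / 1" by (intro frac_le) auto
      also have "\<dots> \<le> \<bar>K\<bar> * sqrt s" using mult_left_mono[OF \<open>sqrt s \<ge> 1\<close>, of "\<bar>K\<bar>"] by simp
      finally show ?thesis using K[OF good] by (meson mult_right_mono norm_ge_zero order_trans)
    qed
    thus ?thesis unfolding P_def by blast
  qed
  \<comment> \<open>Two consecutive orders are carried along because the recurrence has second
    order.\<close>
  have "P j \<and> P (Suc j)" if "j \<le> r" for j
    using that
  proof (induction j rule: inc_induct)
    case base
    show ?case using P_r P_Suc_r by blast
  next
    case (step n)
    thus ?case using weaken \<open>\<And>j. \<lbrakk>j < r; P (Suc j); P (Suc (Suc j))\<rbrakk> \<Longrightarrow> _\<close> by blast
  qed
  hence "\<forall>j. \<exists>K. j < r \<longrightarrow> (\<forall>s x. good s x \<longrightarrow> cmod (Q s j x) \<le> K / sqrt s * cmod (Q s r x))"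
    using step by (meson Suc_leI less_imp_le)
  then obtain K where K: "\<And>j s x. j < r \<Longrightarrow> good s x \<Longrightarrow> cmod (Q s j x) \<le> K j / sqrt s * cmod (Q s r x)"
    by metis
  define K' where "K' = (\<Sum>j<r. \<bar>K j\<bar>)"
  show "\<exists>K\<ge>0. \<forall>s x. \<forall>j<r. good s x \<longrightarrow> cmod (Q s j x) \<le> K / sqrt s * cmod (Q s r x)"
  proof (intro exI[of _ K'] conjI allI impI)
    show "K' \<ge> 0" by (auto simp: K'_def intro: sum_nonneg)
    fix s x j assume j: "j < r" and good: "good s x"
    have "K j \<le> \<bar>K j\<bar>" by simp
    also have "\<dots> \<le> K'" unfolding K'_def using j by (intro member_le_sum) auto
    finally have "K j / sqrt s * cmod (Q s r x) \<le> K' / sqrt s * cmod (Q s r x)"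
      by (intro mult_right_mono divide_right_mono) auto
    thus "cmod (Q s j x) \<le> K' / sqrt s * cmod (Q s r x)" using K[OF j good] by simp
  qed
qed

section \<open>Expansion of the Wronskian\<close>

text \<open>The signed minor belonging to column j of the last row once one more function is
  appended to \<open>fs\<close>; the conditional skips the derivative of order j. For
  \<open>j = length fs\<close> it is the Wronskian of \<open>fs\<close>.\<close>

definition wronskian_cofactor :: "(complex \<Rightarrow> complex) list \<Rightarrow> nat \<Rightarrow> complex \<Rightarrow> complex" where
  "wronskian_cofactor fs j x = (-1) ^ (length fs + j) *
     Determinant.det (Matrix.mat (length fs) (length fs)
       (\<lambda>(i, k). (deriv ^^ (if k < j then k else Suc k)) (fs ! i) x))"

text \<open>Laplace expansion along the last row, the only one that contains \<open>g\<close>: the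
  cofactors stay fixed while the degree of the appended polynomial grows.\<close>

lemma wronskian_snoc:
  "wronskian (fs @ [g]) x = (\<Sum>j<length fs. (deriv ^^ j) g x * wronskian_cofactor fs j x)
     + (deriv ^^ length fs) g x * wronskian fs x"
proof -
  let ?n = "length fs"
  let ?A = "Matrix.mat (Suc ?n) (Suc ?n) (\<lambda>(i, j). (deriv ^^ j) ((fs @ [g]) ! i) x)"
  have cof: "cofactor ?A ?n j = wronskian_cofactor fs j x" if "j \<le> ?n" for j
  proof -
    have "mat_delete ?A ?n j = Matrix.mat ?n ?n (\<lambda>(i, k). (deriv ^^ (if k < j then k else Suc k)) (fs ! i) x)"
      using that by (intro eq_matI) (auto simp: mat_delete_def nth_append)
    thus ?thesis by (simp add: cofactor_def wronskian_cofactor_def)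
  qed
  have last: "wronskian_cofactor fs ?n x = wronskian fs x"
  proof -
    have "Matrix.mat ?n ?n (\<lambda>(i, k). (deriv ^^ (if k < ?n then k else Suc k)) (fs ! i) x) =
        Matrix.mat ?n ?n (\<lambda>(i, k). (deriv ^^ k) (fs ! i) x)"
      by (intro eq_matI) auto
    thus ?thesis by (simp add: wronskian_cofactor_def wronskian_def flip: mult_2)
  qed
  have "wronskian (fs @ [g]) x = Determinant.det ?A" by (simp add: wronskian_def)
  also have "\<dots> = (\<Sum>j<Suc ?n. ?A $$ (?n, j) * cofactor ?A ?n j)"
    by (rule laplace_expansion_row) auto
  also have "\<dots> = (\<Sum>j<Suc ?n. (deriv ^^ j) g x * wronskian_cofactor fs j x)"
    by (intro sum.cong refl) (simp add: cof)
  finally show ?thesis by (simp add: last)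
qed

lemma deriv_funpow_poly: "(deriv ^^ j) (poly p) = poly ((pderiv ^^ j) p)" for p :: "complex poly"
proof (induction j)
  case (Suc j)
  thus ?case by (auto intro!: DERIV_imp_deriv)
qed simp

text \<open>A finite sum of products of derivatives of entire functions. Continuity gives bounds for
  the cofactors on a compact disc.\<close>

lemma continuous_on_wronskian_cofactor:
  assumes "\<And>f. f \<in> set fs \<Longrightarrow> f holomorphic_on UNIV"
  shows "continuous_on S (wronskian_cofactor fs j)"
proof -
  have "continuous_on S ((deriv ^^ k) (fs ! i))" if "i < length fs" for i k
    using assms[of "fs ! i"] that
    by (meson continuous_on_subset holomorphic_higher_deriv holomorphic_on_imp_continuous_on nth_mem open_UNIV subset_UNIV)
  moreover have "i < length fs \<Longrightarrow> \<pi> permutes {0..<length fs} \<Longrightarrow> \<pi> i < length fs" for i \<pi>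
    using permutes_in_image[of \<pi> "{0..<length fs}" i] by simp
  ultimately show ?thesis
    unfolding wronskian_cofactor_def Determinant.det_def
    by (auto intro!: continuous_intros cong: sum.cong prod.cong)
qed

lemma seed_functions_holomorphic:
  assumes "f \<in> set (seed_functions \<alpha> lam mu)"
  shows "f holomorphic_on UNIV"
  using assms unfolding seed_functions_def
  by (auto simp flip: poly_laguerre_poly intro!: holomorphic_intros simp del: upt_Suc)

section \<open>Zeros near a simple zero\<close>

lemma half_line_distance:
  assumes "z \<notin> complex_of_real ` {0..}"
  obtains \<rho> M B where "\<rho> > 0"
    and "\<And>x. x \<in> cball z \<rho> \<Longrightarrow> cmod x \<le> M"
    and "\<And>x t. x \<in> cball z \<rho> \<Longrightarrow> t \<ge> 0 \<Longrightarrow> 1 + t \<le> B * cmod (x - complex_of_real t)"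
proof -
  have "closed (complex_of_real ` {0..})"
  proof -
    have "complex_of_real ` {0..} = {x. Im x = 0 \<and> Re x \<ge> 0}"
      by (auto simp: image_iff complex_eq_iff intro!: bexI[of _ "Re x" for x])
    thus ?thesis
      by (auto intro!: closed_Collect_conj closed_Collect_eq closed_Collect_le continuous_intros)
  qed
  hence "open (- complex_of_real ` {0..})" by (rule open_Compl)
  then obtain d where d: "d > 0" "ball z d \<subseteq> - complex_of_real ` {0..}"
    using assms by (metis ComplI openE)
  define \<rho> where "\<rho> = d / 2"
  define M where "M = cmod z + \<rho>"
  have \<rho>: "\<rho> > 0" using d by (simp add: \<rho>_def)
  have M: "cmod x \<le> M" if "x \<in> cball z \<rho>" for x
    using that norm_triangle_ineq2[of x z] by (auto simp: M_def dist_norm norm_minus_commute)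
  \<comment> \<open>From t \<le> M + |x - t| one gets 1 + t \<le> (1 + M) + |x - t|, and |x - t|
    \<ge> \<rho> absorbs the constant 1 + M.\<close>
  have "1 + t \<le> ((1 + M) / \<rho> + 1) * cmod (x - of_real t)" if x: "x \<in> cball z \<rho>" and "t \<ge> 0" for x t
  proof -
    have "dist z (of_real t) \<ge> d"
      using d(2) that(2) by (meson ComplD atLeast_iff image_eqI linorder_not_le mem_ball subsetD)
    hence *: "cmod (x - of_real t) \<ge> \<rho>"
      using x dist_triangle[of z "of_real t" x] by (simp add: \<rho>_def dist_norm)
    have "M \<ge> 0" using \<rho> by (simp add: M_def)
    hence "(1 + M) / \<rho> * cmod (x - of_real t) \<ge> (1 + M) / \<rho> * \<rho>"
      using * \<rho> by (intro mult_left_mono) auto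
    hence "(1 + M) / \<rho> * cmod (x - of_real t) \<ge> 1 + M"
      using \<rho> by simp
    moreover have "t \<le> cmod x + cmod (x - of_real t)"
      using norm_triangle_ineq4[of x "x - of_real t"] that(2) by simp
    ultimately show ?thesis using M[OF x] unfolding distrib_right by linarith
  qed
  thus thesis using \<rho> M by (blast intro: that)
qed

text \<open>Write p = (X - z) h with h(z) nonzero; by continuity |h| stays above m = |h(z)| / 2 near
  z.\<close>

lemma simple_zero_lower_bound:
  assumes "simple_zero p z" "\<rho> > 0"
  obtains \<delta> m where "0 < \<delta>" "\<delta> \<le> \<rho>" "m > 0"
    "poly p z = 0" "\<And>x. x \<in> cball z \<delta> \<Longrightarrow> m * cmod (x - z) \<le> cmod (poly p x)"
proof -
  have p: "p \<noteq> 0" "Polynomial.order z p = 1" using assms by (auto simp: simple_zero_def)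
  obtain h where h: "p = [:-z, 1:] * h" "\<not> [:-z, 1:] dvd h"
    using order_decomp[OF p(1), of z] p(2) by auto
  hence hz: "poly h z \<noteq> 0" by (simp add: poly_eq_0_iff_dvd)
  have "isCont (\<lambda>x. cmod (poly h x)) z" by (intro continuous_intros)
  hence "eventually (\<lambda>x. cmod (poly h x) > cmod (poly h z) / 2) (at z)"
    using hz by (intro order_tendstoD(1)[where y = "cmod (poly h z)"]) (auto simp: isCont_def)
  then obtain d where d: "d > 0" "\<And>x. x \<noteq> z \<Longrightarrow> dist x z < d \<Longrightarrow> cmod (poly h x) > cmod (poly h z) / 2"
    unfolding eventually_at by auto
  show thesis
  proof (rule that[of "min \<rho> (d / 2)" "cmod (poly h z) / 2"])
    fix x assume x: "x \<in> cball z (min \<rho> (d / 2))"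
    have "cmod (poly h z) / 2 \<le> cmod (poly h x)"
    proof (cases "x = z")
      case False
      moreover have "dist x z < d" using x d(1) by (auto simp: dist_commute)
      ultimately show ?thesis using d(2) by force
    qed simp
    hence "cmod (x - z) * (cmod (poly h z) / 2) \<le> cmod (x - z) * cmod (poly h x)"
      by (intro mult_left_mono) auto
    also have "\<dots> = cmod (poly p x)"
      by (simp add: h(1) norm_mult[symmetric] algebra_simps)
    finally show "cmod (poly h z) / 2 * cmod (x - z) \<le> cmod (poly p x)" by (simp add: mult_ac)
  qed (use assms d hz h in auto)
qed

text \<open>The quotient E / R is within e of W, hence at most e in modulus at z and at least m
  \<delta> - e > e on the circle. A holomorphic function smaller at the centre than on the whole
  circle has a zero inside, by the minimum modulus principle.\<close>

lemma zero_near_perturbed_simple_zero: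
  fixes E R W :: "complex poly"
  assumes "0 < \<delta>" and R: "\<And>x. x \<in> cball z \<delta> \<Longrightarrow> poly R x \<noteq> 0"
    and approx: "\<And>x. x \<in> cball z \<delta> \<Longrightarrow> cmod (poly E x - poly W x * poly R x) \<le> e * cmod (poly R x)"
    and W: "poly W z = 0" "\<And>x. x \<in> cball z \<delta> \<Longrightarrow> m * cmod (x - z) \<le> cmod (poly W x)"
    and "2 * e < m * \<delta>"
  obtains w where "w \<in> ball z \<delta>" "poly E w = 0" "E \<noteq> 0"
proof -
  define G where "G x = poly E x / poly R x" for x
  have G: "cmod (G x - poly W x) \<le> e" if "x \<in> cball z \<delta>" for x
  proof -
    have "G x - poly W x = (poly E x - poly W x * poly R x) / poly R x"
      using R[OF that] by (simp add: G_def field_simps)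
    thus ?thesis using approx[OF that] R[OF that] by (simp add: norm_divide pos_divide_le_eq)
  qed
  have less: "cmod (G z) < cmod (G x)" if "cmod (z - x) = \<delta>" for x
  proof -
    have x: "x \<in> cball z \<delta>" using that by (simp add: dist_norm)
    have "cmod (G z) \<le> e" using G[of z] W(1) \<open>0 < \<delta>\<close> by simp
    also have "e < m * \<delta> - e" using assms by simp
    also have "m * \<delta> \<le> cmod (poly W x)" using W(2)[OF x] that by (simp add: norm_minus_commute)
    also have "cmod (poly W x) - e \<le> cmod (poly W x) - cmod (G x - poly W x)" using G[OF x] by simp
    also have "\<dots> \<le> cmod (G x)"
      using norm_triangle_ineq2[of "poly W x" "poly W x - G x"] by (simp add: norm_minus_commute)
    finally show ?thesis by simp
  qed
  have "G holomorphic_on cball z \<delta>"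
    unfolding G_def using R by (intro holomorphic_intros) auto
  then obtain w where w: "w \<in> ball z \<delta>" "G w = 0"
    using holomorphic_contract_to_zero[of z \<delta> G] less \<open>0 < \<delta>\<close>
    by (metis ball_subset_cball holomorphic_on_imp_continuous_on holomorphic_on_subset)
  have "w \<in> cball z \<delta>" using w by auto
  hence "poly E w = 0" using w(2) R by (auto simp: G_def)
  \<comment> \<open>Needed later because the zero polynomial has by convention an empty multiset of
    roots.\<close>
  moreover have "E \<noteq> 0"
  proof
    assume "E = 0"
    hence "G x = 0" for x by (simp add: G_def)
    thus False using less[of "z + of_real \<delta>"] \<open>0 < \<delta>\<close> by simp
  qed
  ultimately show thesis using w that by blast
qed

theorem theorem6p6:
  fixes lam mu :: "nat list" and \<alpha> :: real and z :: complex
  assumes "is_partition lam" and "is_partition mu"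
    and "\<alpha> + real (length lam + length mu) > -1"
    and "z \<notin> complex_of_real ` {0..}"
    and "simple_zero (gen_laguerre_poly \<alpha> lam mu) z"
  shows "\<exists>c>0. \<exists>n0. \<forall>n\<in>degree_seq lam mu. n \<ge> n0 \<longrightarrow>
    exceptional_zeros \<alpha> lam mu n \<noteq> {#} \<and>
    Min ((\<lambda>w. cmod (z - w)) ` set_mset (exceptional_zeros \<alpha> lam mu n)) < c / sqrt (real n)"
proof -
  define r where "r = length lam + length mu"
  define fs where "fs = seed_functions \<alpha> lam mu"
  define W where "W = gen_laguerre_poly \<alpha> lam mu"
  define k where "k = sum_list lam + sum_list mu"
  define C where "C j x = exp (- of_nat (length mu) * x) * wronskian_cofactor fs j x" for j x
  define Q where "Q s j = (pderiv ^^ j) (laguerre_poly \<alpha> s)" for s j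
  have len: "length fs = r" by (simp add: fs_def r_def seed_functions_def del: upt_Suc)
  obtain \<rho> M B where \<rho>: "\<rho> > 0" and M: "\<And>x. x \<in> cball z \<rho> \<Longrightarrow> cmod x \<le> M"
    and B: "\<And>x t. x \<in> cball z \<rho> \<Longrightarrow> t \<ge> 0 \<Longrightarrow> 1 + t \<le> B * cmod (x - complex_of_real t)"
    using half_line_distance[OF assms(4)] by metis
  obtain \<delta> m where \<delta>: "0 < \<delta>" "\<delta> \<le> \<rho>" and m: "m > 0" and Wz: "poly W z = 0"
    and Wm: "\<And>x. x \<in> cball z \<delta> \<Longrightarrow> m * cmod (x - z) \<le> cmod (poly W x)"
    using simple_zero_lower_bound[OF assms(5) \<rho>] unfolding W_def by metis
  have exp_r: "\<alpha> + real r > -1" using assms(3) by (simp add: r_def)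
  obtain K where K: "K \<ge> 0" "\<And>s x j. x \<in> cball z \<delta> \<Longrightarrow> s \<ge> 2 * r + 2 \<Longrightarrow> j < r \<Longrightarrow>
      cmod (poly (Q s j) x) \<le> K / sqrt s * cmod (poly (Q s r) x)"
    using laguerre_poly_derivs_bound(1)[OF exp_r, of M B] M B \<delta> unfolding Q_def
    by (smt (verit, best) mem_cball)
  have Qr: "poly (Q s r) x \<noteq> 0" if "x \<in> cball z \<delta>" "s \<ge> 2 * r + 2" for s x
    using laguerre_poly_derivs_bound(2)[OF exp_r, of s x M B] M B \<delta> that by (auto simp: Q_def)
  have "\<exists>b. \<forall>x\<in>cball z \<delta>. cmod (C j x) \<le> b" for j
  proof -
    have "continuous_on (cball z \<delta>) (C j)"
      unfolding C_def
      by (intro continuous_intros continuous_on_wronskian_cofactor)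
         (auto simp: fs_def intro: seed_functions_holomorphic)
    hence "bounded (C j ` cball z \<delta>)"
      by (intro compact_imp_bounded compact_continuous_image) auto
    thus ?thesis by (auto simp: bounded_iff)
  qed
  then obtain b where b: "\<And>j x. x \<in> cball z \<delta> \<Longrightarrow> cmod (C j x) \<le> b j" by metis
  \<comment> \<open>\<open>D / sqrt s\<close> will bound the sum of the lower-order terms relative
    to \<open>Q s r\<close> on the disc.\<close>
  define D where "D = (\<Sum>j<r. b j) * K"
  have "b j \<ge> 0" for j using b[of z j] norm_ge_zero[of "C j z"] \<delta> by (simp del: norm_ge_zero)
  hence D: "D \<ge> 0" using K by (auto simp: D_def intro!: mult_nonneg_nonneg sum_nonneg)
  \<comment> \<open>Chosen so that 2 e \<le> 4 D / \<open>sqrt n\<close> < m c /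
    \<open>sqrt n\<close>; the summand 1 keeps this strict, and c positive, when D = 0.\<close>
  define c where "c = 4 * (D + 1) / m"
  have c: "c > 0" using D m by (simp add: c_def)
  obtain N :: nat where N: "c / \<delta> < sqrt (real N)"
  proof -
    obtain N :: nat where "(c / \<delta>)\<^sup>2 < real N" using reals_Archimedean2 by blast
    thus ?thesis using that real_less_rsqrt by blast
  qed
  \<comment> \<open>\<open>N\<close> makes the radius c / \<open>sqrt n\<close> at most \<delta>;
    the other terms give \<open>s \<ge> 2 * r + 2\<close> and make s comparable with n, in the form
    \<open>4 * s \<ge> n\<close> convenient for square roots.\<close>
  define n0 where "n0 = N + 2 * k + 2 * r + 2"
  show ?thesis
  proof (intro exI[of _ c] exI[of _ n0] conjI ballI impI c)
    fix n assume n: "n \<ge> n0"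
    define E where "E = exc_laguerre_poly \<alpha> lam mu n"
    define s where "s = n + length lam - k"
    have s: "s \<ge> 2 * r + 2" "4 * s \<ge> n" and n_pos: "n > 0" using n by (auto simp: s_def n0_def)
    define e where "e = D / sqrt s"
    have "cmod (poly E x - poly W x * poly (Q s r) x) \<le> e * cmod (poly (Q s r) x)"
      if x: "x \<in> cball z \<delta>" for x
    proof -
      have "poly E x = exp (- of_nat (length mu) * x) * wronskian (fs @ [laguerre \<alpha> s]) x"
        unfolding E_def poly_exc_laguerre_poly fs_def s_def k_def ..
      also have "\<dots> = (\<Sum>j<r. poly (Q s j) x * C j x) + poly (Q s r) x * poly W x"
        unfolding wronskian_snoc len W_def poly_gen_laguerre_poly C_def Q_def
        by (simp add: deriv_funpow_poly fs_def algebra_simps sum_distrib_left flip: poly_laguerre_poly)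
      finally have "cmod (poly E x - poly W x * poly (Q s r) x) = cmod (\<Sum>j<r. poly (Q s j) x * C j x)"
        by (simp add: mult.commute)
      also have "\<dots> \<le> (\<Sum>j<r. (K / sqrt s * cmod (poly (Q s r) x)) * b j)"
      proof (rule sum_norm_le)
        fix j assume "j \<in> {..<r}"
        thus "cmod (poly (Q s j) x * C j x) \<le> K / sqrt s * cmod (poly (Q s r) x) * b j"
          unfolding norm_mult using K(1) by (intro mult_mono K(2)[OF x s(1)] b[OF x]) auto
      qed
      also have "\<dots> = e * cmod (poly (Q s r) x)"
        by (simp add: e_def D_def sum_distrib_left sum_distrib_right sum_divide_distrib mult_ac)
      finally show ?thesis .
    qed
    note approx = this
    define d where "d = c / sqrt n"
    have "sqrt N \<le> sqrt n" using n by (simp add: n0_def)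
    hence "c / \<delta> < sqrt n" using N by linarith
    hence d: "0 < d" "d \<le> \<delta>" using c \<delta> n_pos by (auto simp: d_def field_simps)
    hence sub: "cball z d \<subseteq> cball z \<delta>" by auto
    have "2 * e < m * d"
    proof -
      have "sqrt n \<le> sqrt (4 * real s)" using s(2) by (intro real_sqrt_le_mono) linarith
      hence "sqrt n \<le> 2 * sqrt s" by (simp add: real_sqrt_mult)
      hence "e \<le> 2 * D / sqrt n"
        using D s n_pos by (auto simp: e_def field_simps intro: mult_left_mono)
      hence "2 * e \<le> 4 * D / sqrt n" by simp
      also have "\<dots> < 4 * (D + 1) / sqrt n" using n_pos by (intro divide_strict_right_mono) auto
      also have "\<dots> = m * d" using m by (simp add: d_def c_def)
      finally show ?thesis .
    qed
    then obtain w where w: "w \<in> ball z d" "poly E w = 0" "E \<noteq> 0"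
      using zero_near_perturbed_simple_zero[of d z "Q s r" E W e m] d(1) Qr[OF _ s(1)] approx Wz Wm sub
      by (metis subsetD)
    \<comment> \<open>On the positive half-line the defining inequality of \<open>B\<close>, taken
      at t = w, would read 1 + t \<le> 0.\<close>
    have "w \<notin> pos_reals"
    proof
      assume "w \<in> pos_reals"
      then obtain t where "t > 0" "w = of_real t" by auto
      moreover have "w \<in> cball z \<rho>" using w(1) d(2) \<delta>(2) by auto
      ultimately show False using B[of w t] by simp
    qed
    hence mem: "w \<in># exceptional_zeros \<alpha> lam mu n"
      using w(2,3) by (simp add: exceptional_zeros_def E_def)
    thus "exceptional_zeros \<alpha> lam mu n \<noteq> {#}" by auto
    have "Min ((\<lambda>w. cmod (z - w)) ` set_mset (exceptional_zeros \<alpha> lam mu n)) \<le> cmod (z - w)"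
      using mem by (intro Min_le) auto
    also have "\<dots> < c / sqrt n" using w(1) by (simp add: dist_norm d_def)
    finally show "Min ((\<lambda>w. cmod (z - w)) ` set_mset (exceptional_zeros \<alpha> lam mu n)) < c / sqrt (real n)" .
  qed
qed

end
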